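(* Let $\mathrm{I}$ be a set and let $\mathbf{G}:\mathbf{Gl}(\mathrm{I})\to\mathbf{oTop}^{\mathrm{op}}$ be an $\mathbf{oTop}^{\mathrm{op}}$-gluing data functor of type $\mathrm{I}$, where $\mathbf{oTop}$ is the subcategory of $\mathbf{Top}$ whose objects are topological spaces and whose morphisms are open continuous maps. Let $(Q_{\mathbf{G}},\iota_{Q_{\mathbf{G}}}^{\mathrm{op}})$ be the standard representative associated with $\mathbf{G}$. Then, for all $i\in\mathrm{I}$: (1) $\iota_{Q_{\mathbf{G}},i}$ is a topological embedding; (2) $\iota_{Q_{\mathbf{G}},i}(\mathbf{G}(i))$ is an open topological subspace of $Q_{\mathbf{G}}$; (3) $Q_{\mathbf{G}}=\bigcup_{i\in\mathrm{I}}\iota_{Q_{\mathbf{G}},i}(\mathbf{G}(i))$; (4) $Q_{\mathbf{G}}$ is a glued-up $\mathbf{oTop}^{\mathrm{op}}$-object along $\mathbf{G}$ through $\iota_{Q_{\mathbf{G}}}^{\mathrm{op}}$.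
   Context: $\mathbf{Top}$ is the category of topological spaces and continuous maps; for a morphism $f$ of an opposite category, $f^{\mathrm{op}}$ denotes the corresponding morphism of the original category (and conversely). Gluing index category. For a set $\mathrm{I}$, the category $\mathbf{Gl}(\mathrm{I})$ has as objects the equivalence classes of elements of $\mathrm{I}\cup\mathrm{I}^2\cup\mathrm{I}^3$ under the equivalence relation generated by $i\sim(i,i)$, $(i,j,k)\sim(i,k,j)$ and $(i,j,j)\sim(i,j)$; the classes of $i$, $(i,j)$, $(i,j,k)$ are written $[i]$ (or simply $i$), $[i,j]$, $[i,j,k]$. There is at most one morphism between any two objects. The morphisms are the identities, the morphisms $\eta_{i,[i,j]}:i\to[i,j]$, $\tau_{[i,j]}:[j,i]\to[i,j]$, $\eta_{[i,n],[i,j,k]}:[i,n]\to[i,j,k]$ for $n\in\{j,k\}$, $\tau_{k,[i,j]}:[j,i,k]\to[i,j,k]$ (for all $i,j,k\in\mathrm{I}$), and their composites. In $\mathbf{Gl}(\mathrm{I})$, $[i,j,k]$ is the pushout of $[i,j]$ and $[i,k]$ over $i$. The unique morphism $i\to[i,j,k]$ is denoted $\eta_{i,[i,j,k]}$. Gluing data functor. A $\mathbf{C}$-gluing data functor of type $\mathrm{I}$ is a functor $\mathbf{G}:\mathbf{Gl}(\mathrm{I})\to\mathbf{C}$ sending, for all $i,j,k\in\mathrm{I}$, the pushout $[i,j,k]$ to the corresponding pushout in $\mathbf{C}$ (of $\mathbf{G}([i,j])$ and $\mathbf{G}([i,k])$ over $\mathbf{G}([i])$), the image of $\eta_{[i,n],[i,j,k]}$,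 $n\in\{j,k\}$, being the canonical morphism into that pushout. Write $\mathbf{G}(i)=\mathbf{G}([i])$, $\mathbf{G}(i,j)=\mathbf{G}([i,j])$, $\mathbf{G}(i,j,k)=\mathbf{G}([i,j,k])$. Glued-up object. $L$ is a glued-up $\mathbf{C}$-object along $\mathbf{G}$ through $\pi_L=\{\pi_{L,a}:L\to\mathbf{G}(a)\}_a$ if the limit of $\mathbf{G}$ exists and $(L,\pi_L)$ is a cone over $\mathbf{G}$ isomorphic (as a cone) to $\lim\mathbf{G}$. Standard representative. $Q_{\mathbf{G}}=\big(\coprod_{i\in\mathrm{I}}\mathbf{G}(i)\big)/\mathcal{R}_{\mathbf{G}}$, where $\mathcal{R}_{\mathbf{G}}$ is the equivalence relation given by: $(x,i)\,\mathcal{R}_{\mathbf{G}}\,(y,j)$ iff there is $u\in\mathbf{G}(i,j)$ with $x=\mathbf{G}(\eta_{i,[i,j]})^{\mathrm{op}}(u)$ and $y=\mathbf{G}(\eta_{j,[j,i]})^{\mathrm{op}}\circ\mathbf{G}(\tau_{[i,j]})^{\mathrm{op}}(u)$. With $\pi$ the quotient map, the family $\iota_{Q_{\mathbf{G}}}$ consists of $\iota_{Q_{\mathbf{G}},i}:\mathbf{G}(i)\to Q_{\mathbf{G}}$, $x\mapsto\pi(x,i)$; $\iota_{Q_{\mathbf{G}},[i,j]}=\iota_{Q_{\mathbf{G}},i}\circ\mathbf{G}(\eta_{i,[i,j]})^{\mathrm{op}}$; and $\iota_{Q_{\mathbf{G}},[i,j,k]}=\iota_{Q_{\mathbf{G}},i}\circ\mathbf{G}(\eta_{i,[i,j,k]})^{\mathrm{op}}$.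 The space $Q_{\mathbf{G}}$ carries the final topology with respect to the maps $\iota_{Q_{\mathbf{G}},i}$, $i\in\mathrm{I}$. *)

theory Defs
  imports "HOL-Analysis.Analysis"
begin

section \<open>The gluing index category\<close>

datatype 'i word = W1 'i | W2 'i 'i | W3 'i 'i 'i

inductive gl_step :: "'i word \<Rightarrow> 'i word \<Rightarrow> bool" where
  "gl_step (W1 i) (W2 i i)"
| "gl_step (W3 i j k) (W3 i k j)"
| "gl_step (W3 i j j) (W2 i j)"

text \<open>The relation is generated on words over the whole label type. A generating step does not
  change the set of labels of a word, so the words over a set \<open>I\<close> form a union of
  classes, on which it is the relation generated over \<open>I\<close>.\<close>

quotient_type 'i gl = "'i word" / "equivclp gl_step"
  by (rule equivp_evquivclp)

lift_definition gl1 :: "'i \<Rightarrow> 'i gl" is W1 .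
lift_definition gl2 :: "'i \<Rightarrow> 'i \<Rightarrow> 'i gl" is W2 .
lift_definition gl3 :: "'i \<Rightarrow> 'i \<Rightarrow> 'i \<Rightarrow> 'i gl" is W3 .

primrec word_fst :: "'i word \<Rightarrow> 'i" where
  "word_fst (W1 i) = i"
| "word_fst (W2 i j) = i"
| "word_fst (W3 i j k) = i"

lift_definition gl_fst :: "'i gl \<Rightarrow> 'i" is word_fst
proof -
  fix v w :: "'i word"
  assume "equivclp gl_step v w"
  then show "word_fst v = word_fst w"
    by (induction rule: equivclp_induct) (auto elim: gl_step.cases)
qed

lemma gl_fst_simps [simp]:
  "gl_fst (gl1 i) = i" "gl_fst (gl2 i j) = i" "gl_fst (gl3 i j k) = i"
  by (transfer, simp)+

definition gl_obj :: "'i set \<Rightarrow> 'i gl set" where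
  "gl_obj I = {gl1 i |i. i \<in> I} \<union> {gl2 i j |i j. i \<in> I \<and> j \<in> I}
     \<union> {gl3 i j k |i j k. i \<in> I \<and> j \<in> I \<and> k \<in> I}"

text \<open>There is at most one morphism between two objects, so the category is given by the relation
  ``there is a morphism from \<open>a\<close> to \<open>b\<close>''.\<close>

inductive gl_hom :: "'i set \<Rightarrow> 'i gl \<Rightarrow> 'i gl \<Rightarrow> bool" for I where
  id: "a \<in> gl_obj I \<Longrightarrow> gl_hom I a a"
| eta1: "i \<in> I \<Longrightarrow> j \<in> I \<Longrightarrow> gl_hom I (gl1 i) (gl2 i j)"
| tau2: "i \<in> I \<Longrightarrow> j \<in> I \<Longrightarrow> gl_hom I (gl2 j i) (gl2 i j)"
| eta2: "i \<in> I \<Longrightarrow> j \<in> I \<Longrightarrow> k \<in> I \<Longrightarrow> n \<in> {j, k} \<Longrightarrow> gl_hom I (gl2 i n) (gl3 i j k)"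
| tau3: "i \<in> I \<Longrightarrow> j \<in> I \<Longrightarrow> k \<in> I \<Longrightarrow> gl_hom I (gl3 j i k) (gl3 i j k)"
| comp: "gl_hom I a b \<Longrightarrow> gl_hom I b c \<Longrightarrow> gl_hom I a c"


section \<open>The category of topological spaces and open continuous maps\<close>

text \<open>Morphisms are extensional functions, so that equality of morphisms is equality in HOL. Composition
  of \<open>f\<close> from \<open>X\<close> to \<open>Y\<close> with \<open>g\<close> from
  \<open>Y\<close> to \<open>Z\<close> is \<open>compose (topspace X) g f\<close>.\<close>

definition oTop_hom :: "'a topology \<Rightarrow> 'b topology \<Rightarrow> ('a \<Rightarrow> 'b) set" where
  "oTop_hom X Y = {f \<in> extensional (topspace X). continuous_map X Y f \<and> open_map X Y f}"

definition oTop_id :: "'a topology \<Rightarrow> 'a \<Rightarrow> 'a" where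
  "oTop_id X = (\<lambda>x\<in>topspace X. x)"

text \<open>All notions in the opposite category are spelled out with arrows reversed. A pushout in the
  opposite category is thus a pullback: \<open>P\<close>, with projections
  \<open>p\<close> and \<open>q\<close>, is a pullback of
  \<open>f\<close> from \<open>X\<close> to \<open>Z\<close> and
  \<open>g\<close> from \<open>Y\<close> to \<open>Z\<close>.
  HOL formulas cannot quantify over types, so the type \<open>'t\<close> carrying the test
  objects of a universal property is a parameter. A universal property over all spaces amounts to the
  one for every \<open>'t\<close>: in a conclusion \<open>'t\<close> should be left as a
  type variable, while assuming the property for a single type only weakens the hypothesis.\<close>

definition oTop_pullback ::
  "'t itself \<Rightarrow> 'x topology \<Rightarrow> 'y topology \<Rightarrow> 'z topology \<Rightarrow> ('x \<Rightarrow> 'z) \<Rightarrow> ('y \<Rightarrow> 'z)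
    \<Rightarrow> 'p topology \<Rightarrow> ('p \<Rightarrow> 'x) \<Rightarrow> ('p \<Rightarrow> 'y) \<Rightarrow> bool" where
  "oTop_pullback T X Y Z f g P p q \<longleftrightarrow>
     f \<in> oTop_hom X Z \<and> g \<in> oTop_hom Y Z \<and> p \<in> oTop_hom P X \<and> q \<in> oTop_hom P Y \<and>
     compose (topspace P) f p = compose (topspace P) g q \<and>
     (\<forall>(W :: 't topology) h k.
        h \<in> oTop_hom W X \<and> k \<in> oTop_hom W Y \<and>
        compose (topspace W) f h = compose (topspace W) g k \<longrightarrow>
        (\<exists>!u. u \<in> oTop_hom W P \<and> compose (topspace W) p u = h \<and> compose (topspace W) q u = k))"


section \<open>Gluing data functors and glued-up objects\<close>

text \<open>A functor to the opposite category; \<open>Mor G a b\<close> is the underlying open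
  continuous map, from \<open>Ob G b\<close> to \<open>Ob G a\<close>, of the image
  of the morphism from \<open>a\<close> to \<open>b\<close>.\<close>

record ('i, 'a) gl_diagram =
  Ob :: "'i gl \<Rightarrow> 'a topology"
  Mor :: "'i gl \<Rightarrow> 'i gl \<Rightarrow> 'a \<Rightarrow> 'a"

definition gl_functor :: "'i set \<Rightarrow> ('i, 'a) gl_diagram \<Rightarrow> bool" where
  "gl_functor I G \<longleftrightarrow>
     (\<forall>a b. gl_hom I a b \<longrightarrow> Mor G a b \<in> oTop_hom (Ob G b) (Ob G a)) \<and>
     (\<forall>a \<in> gl_obj I. Mor G a a = oTop_id (Ob G a)) \<and>
     (\<forall>a b c. gl_hom I a b \<and> gl_hom I b c \<longrightarrow>
        Mor G a c = compose (topspace (Ob G c)) (Mor G a b) (Mor G b c))"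

definition gluing_data_functor :: "'t itself \<Rightarrow> 'i set \<Rightarrow> ('i, 'a) gl_diagram \<Rightarrow> bool" where
  "gluing_data_functor T I G \<longleftrightarrow> gl_functor I G \<and>
     (\<forall>i\<in>I. \<forall>j\<in>I. \<forall>k\<in>I.
        oTop_pullback T (Ob G (gl2 i j)) (Ob G (gl2 i k)) (Ob G (gl1 i))
          (Mor G (gl1 i) (gl2 i j)) (Mor G (gl1 i) (gl2 i k))
          (Ob G (gl3 i j k))
          (Mor G (gl2 i j) (gl3 i j k)) (Mor G (gl2 i k) (gl3 i j k)))"

text \<open>Cones, limits and isomorphisms of cones are those of the opposite category; their components
  and mediating morphisms are again given by the underlying maps, from
  \<open>Ob G a\<close> to the apex.\<close>

definition gl_cone :: "'i set \<Rightarrow> ('i, 'a) gl_diagram \<Rightarrow> 'l topology \<Rightarrow> ('i gl \<Rightarrow> 'a \<Rightarrow> 'l) \<Rightarrow> bool" where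
  "gl_cone I G L \<pi> \<longleftrightarrow>
     (\<forall>a \<in> gl_obj I. \<pi> a \<in> oTop_hom (Ob G a) L) \<and>
     (\<forall>a b. gl_hom I a b \<longrightarrow> \<pi> b = compose (topspace (Ob G b)) (\<pi> a) (Mor G a b))"

definition gl_limit ::
  "'t itself \<Rightarrow> 'i set \<Rightarrow> ('i, 'a) gl_diagram \<Rightarrow> 'l topology \<Rightarrow> ('i gl \<Rightarrow> 'a \<Rightarrow> 'l) \<Rightarrow> bool" where
  "gl_limit T I G L \<pi> \<longleftrightarrow> gl_cone I G L \<pi> \<and>
     (\<forall>(M :: 't topology) \<mu>. gl_cone I G M \<mu> \<longrightarrow>
        (\<exists>!m. m \<in> oTop_hom L M \<and>
           (\<forall>a \<in> gl_obj I. compose (topspace (Ob G a)) m (\<pi> a) = \<mu> a)))"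

definition gl_cone_iso ::
  "'i set \<Rightarrow> ('i, 'a) gl_diagram \<Rightarrow> 'l topology \<Rightarrow> ('i gl \<Rightarrow> 'a \<Rightarrow> 'l)
    \<Rightarrow> 'm topology \<Rightarrow> ('i gl \<Rightarrow> 'a \<Rightarrow> 'm) \<Rightarrow> bool" where
  "gl_cone_iso I G L \<pi> M \<mu> \<longleftrightarrow>
     (\<exists>f g. f \<in> oTop_hom L M \<and> g \<in> oTop_hom M L \<and>
        compose (topspace L) g f = oTop_id L \<and> compose (topspace M) f g = oTop_id M \<and>
        (\<forall>a \<in> gl_obj I. compose (topspace (Ob G a)) f (\<pi> a) = \<mu> a) \<and>
        (\<forall>a \<in> gl_obj I. compose (topspace (Ob G a)) g (\<mu> a) = \<pi> a))"

text \<open>The limit, which is isomorphic to \<open>L\<close>, can be taken on the carrier type of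
  \<open>L\<close>.\<close>

definition glued_up ::
  "'t itself \<Rightarrow> 'i set \<Rightarrow> ('i, 'a) gl_diagram \<Rightarrow> 'l topology \<Rightarrow> ('i gl \<Rightarrow> 'a \<Rightarrow> 'l) \<Rightarrow> bool" where
  "glued_up T I G L \<pi> \<longleftrightarrow> gl_cone I G L \<pi> \<and>
     (\<exists>(M :: 'l topology) \<mu>. gl_limit T I G M \<mu> \<and> gl_cone_iso I G L \<pi> M \<mu>)"


section \<open>The standard representative\<close>

definition final_topology ::
  "'q set \<Rightarrow> 'i set \<Rightarrow> ('i \<Rightarrow> 'a topology) \<Rightarrow> ('i \<Rightarrow> 'a \<Rightarrow> 'q) \<Rightarrow> 'q topology" where
  "final_topology S I X f =
     topology (\<lambda>U. U \<subseteq> S \<and> (\<forall>i\<in>I. openin (X i) {x \<in> topspace (X i). f i x \<in> U}))"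

lemma openin_final_topology:
  "openin (final_topology S I X f) U \<longleftrightarrow>
     U \<subseteq> S \<and> (\<forall>i\<in>I. openin (X i) {x \<in> topspace (X i). f i x \<in> U})"
proof -
  let ?P = "\<lambda>U. U \<subseteq> S \<and> (\<forall>i\<in>I. openin (X i) {x \<in> topspace (X i). f i x \<in> U})"
  have "istopology ?P"
    unfolding istopology_def
  proof (intro conjI allI impI)
    fix U V assume U: "?P U" and V: "?P V"
    show "U \<inter> V \<subseteq> S" using U by blast
    show "\<forall>i\<in>I. openin (X i) {x \<in> topspace (X i). f i x \<in> U \<inter> V}"
    proof
      fix i assume "i \<in> I"
      have "{x \<in> topspace (X i). f i x \<in> U \<inter> V} =
        {x \<in> topspace (X i). f i x \<in> U} \<inter> {x \<in> topspace (X i). f i x \<in> V}" by blast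
      then show "openin (X i) {x \<in> topspace (X i). f i x \<in> U \<inter> V}"
        using U V \<open>i \<in> I\<close> by (simp add: openin_Int)
    qed
  next
    fix K assume K: "\<forall>U\<in>K. ?P U"
    show "\<Union>K \<subseteq> S" using K by blast
    show "\<forall>i\<in>I. openin (X i) {x \<in> topspace (X i). f i x \<in> \<Union>K}"
    proof
      fix i assume "i \<in> I"
      have "{x \<in> topspace (X i). f i x \<in> \<Union>K} =
        (\<Union>U\<in>K. {x \<in> topspace (X i). f i x \<in> U})" by blast
      then show "openin (X i) {x \<in> topspace (X i). f i x \<in> \<Union>K}"
        using K \<open>i \<in> I\<close> by auto
    qed
  qed
  then show ?thesis
    unfolding final_topology_def by (simp add: topology_inverse')
qed

definition gl_sum :: "'i set \<Rightarrow> ('i, 'a) gl_diagram \<Rightarrow> ('a \<times> 'i) set" where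
  "gl_sum I G = {(x, i). i \<in> I \<and> x \<in> topspace (Ob G (gl1 i))}"

definition gl_rel :: "'i set \<Rightarrow> ('i, 'a) gl_diagram \<Rightarrow> (('a \<times> 'i) \<times> ('a \<times> 'i)) set" where
  "gl_rel I G = {((x, i), (y, j)) | x i y j. i \<in> I \<and> j \<in> I \<and>
     (\<exists>u \<in> topspace (Ob G (gl2 i j)).
        x = Mor G (gl1 i) (gl2 i j) u \<and>
        y = Mor G (gl1 j) (gl2 j i) (Mor G (gl2 j i) (gl2 i j) u))}"

definition Q_iota1 :: "'i set \<Rightarrow> ('i, 'a) gl_diagram \<Rightarrow> 'i \<Rightarrow> 'a \<Rightarrow> ('a \<times> 'i) set" where
  "Q_iota1 I G i = (\<lambda>x \<in> topspace (Ob G (gl1 i)). gl_rel I G `` {(x, i)})"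

definition Q_space :: "'i set \<Rightarrow> ('i, 'a) gl_diagram \<Rightarrow> ('a \<times> 'i) set topology" where
  "Q_space I G = final_topology (gl_sum I G // gl_rel I G) I (\<lambda>i. Ob G (gl1 i)) (Q_iota1 I G)"

text \<open>The first label of a word only depends on its class, so this covers the three cases
  \<open>a = gl1 i\<close>, \<open>a = gl2 i j\<close> and
  \<open>a = gl3 i j k\<close> at once; in the first case the inner map is the identity.\<close>

definition Q_iota :: "'i set \<Rightarrow> ('i, 'a) gl_diagram \<Rightarrow> 'i gl \<Rightarrow> 'a \<Rightarrow> ('a \<times> 'i) set" where
  "Q_iota I G a =
     compose (topspace (Ob G a)) (Q_iota1 I G (gl_fst a)) (Mor G (gl1 (gl_fst a)) a)"

end

theory Submission
  imports Defs
begin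

text \<open>The idea is that the pieces \<open>G(i)\<close> are glued along their overlaps
  \<open>G(i,j)\<close>, and that the formal properties of \<open>G\<close> make the explicit gluing
  relation an equivalence relation with open charts.

  Reflexivity, symmetry and the absence of identifications inside one piece come from
  functoriality together with \<open>[i,i] = [i]\<close> (lemma \<open>gl_rel_same_index\<close>). Hence
  the charts are injective. Transitivity (\<open>gl_rel_trans\<close>) needs a point of
  \<open>G(j,i,k)\<close> above two points of \<open>G(j,i)\<close> and \<open>G(j,k)\<close> that agree
  in \<open>G(j)\<close>. The pullback property provides it when it is tested on the topological
  fibre product of \<open>G(j,i)\<close> and \<open>G(j,k)\<close>, which is a legitimate test object
  in the category of open maps since its projections are open (\<open>oTop_pullback_point\<close>). This
  fibre product lives on pairs, which is why pairs are the type of test objects in the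
  hypothesis.

  The charts are continuous by definition of the final topology. They are open
  (\<open>Q_iota1_hom\<close>) because the saturation of an open set of one piece meets any other piece
  in the image of an open set of the overlap under an open map. Being injective, they are open
  embeddings, and they cover \<open>Q\<close> by construction.

  For the limit in the opposite category, which is a colimit of open maps, a cone with apex
  \<open>M\<close> is the same as a family of open continuous maps from the pieces to \<open>M\<close>
  that agree on glued points. It therefore descends uniquely to \<open>Q\<close>, and the descended map
  is again continuous and open because both properties can be checked on the charts
  (\<open>Q_space_hom_if_charts\<close>). So \<open>Q\<close> itself is a limit.\<close>

section \<open>Points of pullbacks of open maps\<close>

text \<open>Openness is checked on boxes \<open>A \<times> B\<close>: the points of
  \<open>A\<close> that have a partner in \<open>B\<close> are those that \<open>f\<close> sends into
  the open set \<open>g ` B\<close>.\<close>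

lemma open_map_fst_fibre_product:
  assumes f: "continuous_map X Z f" and g: "open_map Y Z g"
  shows "open_map (subtopology (prod_topology X Y) {z. f (fst z) = g (snd z)}) X fst"
  unfolding open_map_def
proof (intro allI impI)
  fix U
  assume "openin (subtopology (prod_topology X Y) {z. f (fst z) = g (snd z)}) U"
  then obtain V where V: "openin (prod_topology X Y) V"
    and U: "U = V \<inter> {z. f (fst z) = g (snd z)}"
    by (auto simp: openin_subtopology)
  show "openin X (fst ` U)"
  proof (subst openin_subopen, intro ballI)
    fix x assume "x \<in> fst ` U"
    then obtain y where xy: "(x, y) \<in> V" "f x = g y"
      using U by auto
    then obtain A B where AB: "openin X A" "openin Y B" "x \<in> A" "y \<in> B" "A \<times> B \<subseteq> V"
      using V unfolding openin_prod_topology_alt by meson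
    let ?N = "{a \<in> topspace X. f a \<in> g ` B} \<inter> A"
    have "openin Z (g ` B)"
      using g AB unfolding open_map_def by blast
    then have "openin X ?N"
      using f AB openin_continuous_map_preimage by blast
    moreover have "x \<in> ?N"
      using AB xy openin_subset by fastforce
    moreover have "?N \<subseteq> fst ` U"
      using AB U by force
    ultimately show "\<exists>T. openin X T \<and> x \<in> T \<and> T \<subseteq> fst ` U"
      by blast
  qed
qed

lemma open_map_snd_fibre_product:
  assumes f: "open_map X Z f" and g: "continuous_map Y Z g"
  shows "open_map (subtopology (prod_topology X Y) {z. f (fst z) = g (snd z)}) Y snd"
  unfolding open_map_def
proof (intro allI impI)
  let ?swap = "\<lambda>(x, y). (y, x)"
  let ?W = "subtopology (prod_topology X Y) {z. f (fst z) = g (snd z)}"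
  let ?W' = "subtopology (prod_topology Y X) {z. g (fst z) = f (snd z)}"
  fix U assume U: "openin ?W U"
  have "homeomorphic_map (prod_topology X Y) (prod_topology Y X) ?swap"
    by (rule homeomorphic_map_swap)
  then have "homeomorphic_map ?W ?W' ?swap"
    by (rule homeomorphic_map_subtopologies) auto
  then have "openin ?W' (?swap ` U)"
    using U by (meson homeomorphic_imp_open_map open_map_def)
  then have "openin Y (fst ` ?swap ` U)"
    using open_map_fst_fibre_product[OF g f] unfolding open_map_def by blast
  moreover have "fst ` ?swap ` U = snd ` U"
    by force
  ultimately show "openin Y (snd ` U)" by simp
qed

text \<open>The pullback is only known through its universal property, tested against spaces with open
  maps, so it has to be shown that it has enough points. The topological fibre product has open
  projections because open maps are stable under base change. It can therefore serve as test object, and the mediating map from it hits a point above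
  every compatible pair.\<close>

lemma oTop_pullback_point:
  fixes X :: "'x topology" and Y :: "'y topology"
  assumes pb: "oTop_pullback TYPE('x \<times> 'y) X Y Z f g P p q"
    and x: "x \<in> topspace X" and y: "y \<in> topspace Y" and xy: "f x = g y"
  obtains w where "w \<in> topspace P" "p w = x" "q w = y"
proof -
  have f: "continuous_map X Z f" "open_map X Z f" and g: "continuous_map Y Z g" "open_map Y Z g"
    using pb unfolding oTop_pullback_def oTop_hom_def by auto
  define W where "W = subtopology (prod_topology X Y) {z. f (fst z) = g (snd z)}"
  define h where "h = restrict fst (topspace W)"
  define k where "k = restrict snd (topspace W)"
  have "continuous_map W X fst" "continuous_map W Y snd"
    unfolding W_def
    by (auto intro: continuous_map_from_subtopology continuous_map_fst continuous_map_snd)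
  moreover have "open_map W X fst" "open_map W Y snd"
    unfolding W_def using open_map_fst_fibre_product open_map_snd_fibre_product f g by blast+
  ultimately have hk: "h \<in> oTop_hom W X" "k \<in> oTop_hom W Y"
    unfolding oTop_hom_def h_def k_def
    by (auto intro: continuous_map_eq open_map_eq)
  have "compose (topspace W) f h = compose (topspace W) g k"
    by (auto simp: compose_def h_def k_def W_def fun_eq_iff)
  then obtain u where u: "u \<in> oTop_hom W P"
    "compose (topspace W) p u = h" "compose (topspace W) q u = k"
    using pb hk unfolding oTop_pullback_def by meson
  have z: "(x, y) \<in> topspace W"
    using x y xy by (simp add: W_def)
  show thesis
  proof
    show "u (x, y) \<in> topspace P"
      using u(1) z by (auto simp: oTop_hom_def continuous_map_def)
    show "p (u (x, y)) = x"
      using fun_cong[OF u(2), of "(x, y)"] z by (simp add: compose_def h_def)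
    show "q (u (x, y)) = y"
      using fun_cong[OF u(3), of "(x, y)"] z by (simp add: compose_def k_def)
  qed
qed


section \<open>Open continuous maps\<close>

lemma oTop_hom_comp:
  assumes "f \<in> oTop_hom X Y" "g \<in> oTop_hom Y Z"
  shows "compose (topspace X) g f \<in> oTop_hom X Z"
  using assms unfolding oTop_hom_def
  by (auto simp: compose_def o_def
      intro: continuous_map_eq[OF continuous_map_compose] open_map_eq[OF open_map_compose])

lemma oTop_hom_image: "f \<in> oTop_hom X Y \<Longrightarrow> x \<in> topspace X \<Longrightarrow> f x \<in> topspace Y"
  by (auto simp: oTop_hom_def continuous_map_def)

lemma oTop_id_hom: "oTop_id X \<in> oTop_hom X X"
  unfolding oTop_hom_def oTop_id_def
  by (auto intro: continuous_map_eq[OF continuous_map_id] open_map_eq[OF open_map_id])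

lemma oTop_hom_preimage:
  "f \<in> oTop_hom X Y \<Longrightarrow> openin Y U \<Longrightarrow> openin X {x \<in> topspace X. f x \<in> U}"
  by (auto simp: oTop_hom_def openin_continuous_map_preimage)

lemma oTop_hom_open_image: "f \<in> oTop_hom X Y \<Longrightarrow> openin X U \<Longrightarrow> openin Y (f ` U)"
  by (auto simp: oTop_hom_def open_map_def)


section \<open>Objects and morphisms of the gluing category\<close>

lemma gl2_diag: "gl2 i i = gl1 i"
  by transfer (meson gl_step.intros r_into_equivclp equivclp_sym)

lemma gl3_diag: "gl3 i j j = gl2 i j"
  by transfer (meson gl_step.intros r_into_equivclp)

lemma gl_obj_cases:
  assumes "a \<in> gl_obj I"
  obtains i j k where "i \<in> I" "j \<in> I" "k \<in> I" "a = gl3 i j k"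
  using assms unfolding gl_obj_def by (auto simp flip: gl2_diag gl3_diag)

lemma gl_obj_intros [simp]:
  "i \<in> I \<Longrightarrow> gl1 i \<in> gl_obj I"
  "i \<in> I \<Longrightarrow> j \<in> I \<Longrightarrow> gl2 i j \<in> gl_obj I"
  "i \<in> I \<Longrightarrow> j \<in> I \<Longrightarrow> k \<in> I \<Longrightarrow> gl3 i j k \<in> gl_obj I"
  unfolding gl_obj_def by blast+

lemma gl_fst_mem: "a \<in> gl_obj I \<Longrightarrow> gl_fst a \<in> I"
  by (auto elim: gl_obj_cases)

lemma gl_hom_fst: "a \<in> gl_obj I \<Longrightarrow> gl_hom I (gl1 (gl_fst a)) a"
proof (elim gl_obj_cases)
  fix i j k assume "i \<in> I" "j \<in> I" "k \<in> I" and a: "a = gl3 i j k"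
  then have "gl_hom I (gl1 i) (gl2 i j)" "gl_hom I (gl2 i j) (gl3 i j k)"
    by (auto intro: gl_hom.eta1 gl_hom.eta2)
  then show ?thesis
    using a gl_hom.comp by simp
qed

lemma gl_hom_second:
  assumes "i \<in> I" "j \<in> I"
  shows "gl_hom I (gl1 j) (gl2 i j)"
  by (rule gl_hom.comp[OF gl_hom.eta1 gl_hom.tau2]) (rule assms)+

lemma gl_hom_last_two:
  assumes "i \<in> I" "j \<in> I" "k \<in> I"
  shows "gl_hom I (gl2 i k) (gl3 j i k)"
proof (rule gl_hom.comp)
  show "gl_hom I (gl2 i k) (gl3 i j k)"
    using assms by (simp add: gl_hom.eta2)
  show "gl_hom I (gl3 i j k) (gl3 j i k)"
    using assms by (simp add: gl_hom.tau3)
qed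

lemma gl_hom_obj: "gl_hom I a b \<Longrightarrow> a \<in> gl_obj I \<and> b \<in> gl_obj I"
  by (induction rule: gl_hom.induct) auto


section \<open>The equivalence relation and the charts\<close>

locale oTop_gluing =
  fixes I :: "'i set" and G :: "('i, 'a) gl_diagram"
  assumes gluing: "gluing_data_functor TYPE('a \<times> 'a) I G"
begin

abbreviation pts :: "'i gl \<Rightarrow> 'a set" where
  "pts a \<equiv> topspace (Ob G a)"

lemma Mor_hom: "gl_hom I a b \<Longrightarrow> Mor G a b \<in> oTop_hom (Ob G b) (Ob G a)"
  using gluing unfolding gluing_data_functor_def gl_functor_def by blast

lemma Mor_pts: "gl_hom I a b \<Longrightarrow> w \<in> pts b \<Longrightarrow> Mor G a b w \<in> pts a"
  by (rule oTop_hom_image[OF Mor_hom])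

lemma Mor_id: "a \<in> gl_obj I \<Longrightarrow> w \<in> pts a \<Longrightarrow> Mor G a a w = w"
  using gluing unfolding gluing_data_functor_def gl_functor_def
  by (simp add: oTop_id_def)

lemma Mor_comp:
  "gl_hom I a b \<Longrightarrow> gl_hom I b c \<Longrightarrow> w \<in> pts c \<Longrightarrow> Mor G a b (Mor G b c w) = Mor G a c w"
proof -
  assume hom: "gl_hom I a b" "gl_hom I b c" and w: "w \<in> pts c"
  have "Mor G a c = compose (pts c) (Mor G a b) (Mor G b c)"
    using gluing hom unfolding gluing_data_functor_def gl_functor_def by blast
  then show ?thesis
    using w by (simp add: compose_eq)
qed

text \<open>Two points are identified when they come from one point of the overlap; since all morphisms
  with the same source and target agree, the transition map disappears from this description.\<close>

lemma gl_rel_iff: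
  "((x, i), (y, j)) \<in> gl_rel I G \<longleftrightarrow> i \<in> I \<and> j \<in> I \<and>
     (\<exists>u \<in> pts (gl2 i j). x = Mor G (gl1 i) (gl2 i j) u \<and> y = Mor G (gl1 j) (gl2 i j) u)"
  unfolding gl_rel_def by (auto simp: Mor_comp gl_hom.eta1 gl_hom.tau2)

text \<open>A point of any space that maps to the overlap \<open>G(i,j)\<close> may witness a gluing;
  this lets triple overlaps be used directly.\<close>

lemma gl_relI:
  assumes "i \<in> I" "j \<in> I" "gl_hom I (gl2 i j) b" "w \<in> pts b"
  shows "((Mor G (gl1 i) b w, i), (Mor G (gl1 j) b w, j)) \<in> gl_rel I G"
proof -
  have "gl_hom I (gl1 i) (gl2 i j)" "gl_hom I (gl1 j) (gl2 i j)"
    using assms by (simp_all add: gl_hom.eta1 gl_hom_second)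
  then show ?thesis
    unfolding gl_rel_iff using assms
    by (intro conjI bexI[of _ "Mor G (gl2 i j) b w"]) (auto simp: Mor_comp Mor_pts)
qed

text \<open>The index \<open>[i,i]\<close> is \<open>i\<close> itself, so no two distinct points of one
  piece are identified.\<close>

lemma gl_rel_same_index: "((x, i), (y, i)) \<in> gl_rel I G \<longleftrightarrow> i \<in> I \<and> x \<in> pts (gl1 i) \<and> x = y"
  unfolding gl_rel_iff gl2_diag by (auto simp: Mor_id)

lemma gl_rel_sym: "((x, i), (y, j)) \<in> gl_rel I G \<Longrightarrow> ((y, j), (x, i)) \<in> gl_rel I G"
proof -
  assume "((x, i), (y, j)) \<in> gl_rel I G"
  then obtain u where "i \<in> I" "j \<in> I" "u \<in> pts (gl2 i j)"
      "x = Mor G (gl1 i) (gl2 i j) u" "y = Mor G (gl1 j) (gl2 i j) u"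
    by (auto simp: gl_rel_iff)
  then show ?thesis
    using gl_relI[of j i "gl2 i j" u] by (simp add: gl_hom.tau2)
qed

text \<open>Transitivity is where the pullback condition enters: points \<open>u\<close> of
  \<open>G(j,i)\<close> and \<open>v\<close> of \<open>G(j,k)\<close> over the same point of
  \<open>G(j)\<close> come from one point of \<open>G(j,i,k)\<close>, which maps to
  \<open>G(i,k)\<close>.\<close>

lemma gl_rel_trans:
  assumes xy: "((x, i), (y, j)) \<in> gl_rel I G" and yz: "((y, j), (z, k)) \<in> gl_rel I G"
  shows "((x, i), (z, k)) \<in> gl_rel I G"
proof -
  have ijk: "i \<in> I" "j \<in> I" "k \<in> I"
    using xy yz by (auto simp: gl_rel_iff)
  obtain u where u: "u \<in> pts (gl2 j i)" "y = Mor G (gl1 j) (gl2 j i) u"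
      "x = Mor G (gl1 i) (gl2 j i) u"
    using gl_rel_sym[OF xy] by (auto simp: gl_rel_iff)
  obtain v where v: "v \<in> pts (gl2 j k)" "y = Mor G (gl1 j) (gl2 j k) v"
      "z = Mor G (gl1 k) (gl2 j k) v"
    using yz by (auto simp: gl_rel_iff)
  let ?b = "gl3 j i k"
  have pb: "oTop_pullback TYPE('a \<times> 'a) (Ob G (gl2 j i)) (Ob G (gl2 j k)) (Ob G (gl1 j))
          (Mor G (gl1 j) (gl2 j i)) (Mor G (gl1 j) (gl2 j k))
          (Ob G ?b) (Mor G (gl2 j i) ?b) (Mor G (gl2 j k) ?b)"
    using gluing ijk unfolding gluing_data_functor_def by blast
  obtain w where w: "w \<in> pts ?b" "Mor G (gl2 j i) ?b w = u" "Mor G (gl2 j k) ?b w = v"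
    using oTop_pullback_point[OF pb u(1) v(1)] u(2) v(2) by auto
  have b: "gl_hom I (gl2 j i) ?b" "gl_hom I (gl2 j k) ?b"
    using ijk by (auto intro: gl_hom.eta2)
  have "gl_hom I (gl1 i) (gl2 j i)" "gl_hom I (gl1 k) (gl2 j k)"
    using ijk by (simp_all add: gl_hom_second)
  then have "x = Mor G (gl1 i) ?b w" "z = Mor G (gl1 k) ?b w"
    using Mor_comp[OF _ b(1) w(1)] Mor_comp[OF _ b(2) w(1)] w u(3) v(3) by simp_all
  moreover have "gl_hom I (gl2 i k) ?b"
    using ijk by (simp add: gl_hom_last_two)
  ultimately show ?thesis
    using gl_relI w(1) ijk by simp
qed

lemma equiv_gl_rel: "equiv (gl_sum I G) (gl_rel I G)"
proof (rule equivI)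
  have "(x, i) \<in> gl_sum I G" if "((x, i), (y, j)) \<in> gl_rel I G" for x i y j
    using gl_rel_trans[OF that gl_rel_sym[OF that]] by (simp add: gl_rel_same_index gl_sum_def)
  moreover have "sym (gl_rel I G)"
    by (rule symI) (metis gl_rel_sym surj_pair)
  ultimately show "gl_rel I G \<subseteq> gl_sum I G \<times> gl_sum I G" "sym (gl_rel I G)"
    by (auto dest: symD)
  show "refl_on (gl_sum I G) (gl_rel I G)"
    by (rule refl_onI) (auto simp: gl_sum_def gl_rel_same_index)
  show "trans (gl_rel I G)"
    by (rule transI) (metis gl_rel_trans surj_pair)
qed

lemma Q_iota1_eq_iff:
  assumes "i \<in> I" "j \<in> I" "x \<in> pts (gl1 i)" "y \<in> pts (gl1 j)"
  shows "Q_iota1 I G i x = Q_iota1 I G j y \<longleftrightarrow> ((x, i), (y, j)) \<in> gl_rel I G"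
  unfolding Q_iota1_def using assms eq_equiv_class_iff[OF equiv_gl_rel, of "(x, i)" "(y, j)"]
  by (auto simp: gl_sum_def)

lemma quotient_eq_charts: "gl_sum I G // gl_rel I G = (\<Union>i\<in>I. Q_iota1 I G i ` pts (gl1 i))"
  unfolding quotient_def gl_sum_def Q_iota1_def by auto

lemma openin_Q_space:
  "openin (Q_space I G) U \<longleftrightarrow> U \<subseteq> (\<Union>i\<in>I. Q_iota1 I G i ` pts (gl1 i)) \<and>
     (\<forall>i\<in>I. openin (Ob G (gl1 i)) {x \<in> pts (gl1 i). Q_iota1 I G i x \<in> U})"
  unfolding Q_space_def openin_final_topology quotient_eq_charts ..

lemma topspace_Q_space: "topspace (Q_space I G) = (\<Union>i\<in>I. Q_iota1 I G i ` pts (gl1 i))"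
proof
  let ?S = "\<Union>i\<in>I. Q_iota1 I G i ` pts (gl1 i)"
  have "{x \<in> pts (gl1 i). Q_iota1 I G i x \<in> ?S} = pts (gl1 i)" if "i \<in> I" for i
    using that by blast
  then have "openin (Q_space I G) ?S"
    by (simp add: openin_Q_space)
  then show "?S \<subseteq> topspace (Q_space I G)"
    by (rule openin_subset)
  show "topspace (Q_space I G) \<subseteq> ?S"
    using openin_topspace openin_Q_space by blast
qed

text \<open>Openness of the charts uses openness of the structure maps: the part of piece
  \<open>j\<close> glued to an open set \<open>U\<close> of piece \<open>i\<close> is the image in
  piece \<open>j\<close> of the preimage of \<open>U\<close> in the overlap.\<close>

lemma Q_iota1_hom:
  assumes i: "i \<in> I"
  shows "Q_iota1 I G i \<in> oTop_hom (Ob G (gl1 i)) (Q_space I G)"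
proof -
  have "continuous_map (Ob G (gl1 i)) (Q_space I G) (Q_iota1 I G i)"
    unfolding continuous_map_def using i by (auto simp: openin_Q_space topspace_Q_space)
  moreover have "open_map (Ob G (gl1 i)) (Q_space I G) (Q_iota1 I G i)"
    unfolding open_map_def openin_Q_space
  proof (intro allI impI conjI ballI)
    fix U assume U: "openin (Ob G (gl1 i)) U"
    then have sub: "U \<subseteq> pts (gl1 i)"
      by (rule openin_subset)
    then show "Q_iota1 I G i ` U \<subseteq> (\<Union>i\<in>I. Q_iota1 I G i ` pts (gl1 i))"
      using i by blast
    fix j assume j: "j \<in> I"
    have hom: "gl_hom I (gl1 i) (gl2 i j)" "gl_hom I (gl1 j) (gl2 i j)"
      using i j by (simp_all add: gl_hom.eta1 gl_hom_second)
    let ?V = "{u \<in> pts (gl2 i j). Mor G (gl1 i) (gl2 i j) u \<in> U}"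
    have "{y \<in> pts (gl1 j). Q_iota1 I G j y \<in> Q_iota1 I G i ` U} =
      {y \<in> pts (gl1 j). \<exists>x\<in>U. ((x, i), (y, j)) \<in> gl_rel I G}"
      using Q_iota1_eq_iff[OF i j] sub by (force simp: image_iff)
    also have "\<dots> = Mor G (gl1 j) (gl2 i j) ` ?V"
      using i j Mor_pts[OF hom(2)] by (auto simp: gl_rel_iff)
    also have "openin (Ob G (gl1 j)) \<dots>"
      by (rule oTop_hom_open_image[OF Mor_hom[OF hom(2)] oTop_hom_preimage[OF Mor_hom[OF hom(1)] U]])
    finally show "openin (Ob G (gl1 j)) {y \<in> pts (gl1 j). Q_iota1 I G j y \<in> Q_iota1 I G i ` U}" .
  qed
  ultimately show ?thesis
    by (auto simp: oTop_hom_def Q_iota1_def)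
qed

lemma Q_iota1_embedding:
  assumes i: "i \<in> I"
  shows "embedding_map (Ob G (gl1 i)) (Q_space I G) (Q_iota1 I G i)"
proof (rule injective_open_imp_embedding_map)
  show "inj_on (Q_iota1 I G i) (pts (gl1 i))"
    using i by (auto intro!: inj_onI simp: Q_iota1_eq_iff gl_rel_same_index)
qed (use Q_iota1_hom[OF i] in \<open>auto simp: oTop_hom_def\<close>)


section \<open>The colimit property\<close>

text \<open>This is the compatibility of the charts with the diagram, before passing to classes. It is
  enough to check the generating morphisms: those that keep the first index compare a point with
  itself, those that exchange the first two indices \<open>i\<close>, \<open>j\<close> use the
  image of the point in \<open>G(i,j)\<close>, and composites follow by transitivity of the gluing
  relation.\<close>

lemma gl_rel_along_hom:
  assumes "gl_hom I a b" "w \<in> pts b"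
  shows "((Mor G (gl1 (gl_fst a)) b w, gl_fst a), (Mor G (gl1 (gl_fst b)) b w, gl_fst b))
    \<in> gl_rel I G"
  using assms
proof (induction arbitrary: w rule: gl_hom.induct)
  case (id a)
  then show ?case
    by (simp add: gl_rel_same_index gl_fst_mem Mor_pts[OF gl_hom_fst])
next
  case (eta1 i j)
  then show ?case
    by (simp add: gl_rel_same_index Mor_pts[OF gl_hom.eta1])
next
  case (tau2 i j)
  then show ?case
    using gl_relI[OF _ _ gl_hom.tau2] by simp
next
  case (eta2 i j k n)
  then show ?case
    using gl_hom_fst[of "gl3 i j k" I] by (simp add: gl_rel_same_index Mor_pts)
next
  case (tau3 i j k)
  then have "gl_hom I (gl2 j i) (gl3 j i k)" "gl_hom I (gl3 j i k) (gl3 i j k)"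
    by (auto intro: gl_hom.eta2 gl_hom.tau3)
  then have "gl_hom I (gl2 j i) (gl3 i j k)"
    by (rule gl_hom.comp)
  then show ?case
    using gl_relI[of j i "gl3 i j k" w] tau3 by simp
next
  case (comp a b c)
  have "a \<in> gl_obj I" "b \<in> gl_obj I"
    using comp.hyps gl_hom_obj by auto
  then have "gl_hom I (gl1 (gl_fst a)) b" "gl_hom I (gl1 (gl_fst b)) b"
    using comp.hyps gl_hom_fst gl_hom.comp by blast+
  then show ?case
    using comp.IH(1)[of "Mor G b c w"] comp.IH(2)[of w] comp.hyps(2) comp.prems
    by (simp add: Mor_comp Mor_pts gl_rel_trans)
qed

lemma Q_iota_apply:
  "w \<in> pts a \<Longrightarrow> Q_iota I G a w = Q_iota1 I G (gl_fst a) (Mor G (gl1 (gl_fst a)) a w)"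
  by (simp add: Q_iota_def compose_eq)

lemma Q_iota_gl1: "i \<in> I \<Longrightarrow> Q_iota I G (gl1 i) = Q_iota1 I G i"
  by (rule extensionalityI[of _ "pts (gl1 i)"])
    (simp_all add: Q_iota_apply Mor_id, simp_all add: Q_iota_def Q_iota1_def)

lemma Q_iota_cone: "gl_cone I G (Q_space I G) (Q_iota I G)"
  unfolding gl_cone_def
proof (intro conjI ballI allI impI)
  fix a assume "a \<in> gl_obj I"
  then show "Q_iota I G a \<in> oTop_hom (Ob G a) (Q_space I G)"
    unfolding Q_iota_def
    by (intro oTop_hom_comp[OF Mor_hom Q_iota1_hom] gl_hom_fst gl_fst_mem)
next
  fix a b assume ab: "gl_hom I a b"
  then have obj: "a \<in> gl_obj I" "b \<in> gl_obj I"
    using gl_hom_obj by auto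
  have "Q_iota I G b w = Q_iota I G a (Mor G a b w)" if w: "w \<in> pts b" for w
  proof -
    have hom: "gl_hom I (gl1 (gl_fst a)) b" "gl_hom I (gl1 (gl_fst b)) b"
      using obj ab gl_hom_fst gl_hom.comp by blast+
    have "Q_iota I G a (Mor G a b w) = Q_iota1 I G (gl_fst a) (Mor G (gl1 (gl_fst a)) b w)"
      using w ab obj by (simp add: Q_iota_apply Mor_pts Mor_comp gl_hom_fst)
    also have "\<dots> = Q_iota I G b w"
      using gl_rel_along_hom[OF ab w] w hom obj
      by (simp add: Q_iota_apply Q_iota1_eq_iff Mor_pts gl_fst_mem)
    finally show ?thesis ..
  qed
  then show "Q_iota I G b = compose (topspace (Ob G b)) (Q_iota I G a) (Mor G a b)"
    by (intro extensionalityI[of _ "topspace (Ob G b)"]) (auto simp: compose_eq Q_iota_def[of _ _ b])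
qed

lemma cone_gl_rel:
  assumes cone: "gl_cone I G M \<mu>" and rel: "((x, i), (y, j)) \<in> gl_rel I G"
  shows "\<mu> (gl1 i) x = \<mu> (gl1 j) y"
proof -
  obtain u where u: "u \<in> pts (gl2 i j)" "x = Mor G (gl1 i) (gl2 i j) u"
      "y = Mor G (gl1 j) (gl2 i j) u" and ij: "i \<in> I" "j \<in> I"
    using rel by (auto simp: gl_rel_iff)
  have "gl_hom I (gl1 i) (gl2 i j)" "gl_hom I (gl1 j) (gl2 i j)"
    using ij by (simp_all add: gl_hom.eta1 gl_hom_second)
  then have "\<mu> (gl2 i j) u = \<mu> (gl1 i) x" "\<mu> (gl2 i j) u = \<mu> (gl1 j) y"
    using cone u unfolding gl_cone_def by (metis compose_eq)+
  then show ?thesis by simp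
qed

text \<open>Continuity is the universal property of the final topology. Openness is local on the
  source, because \<open>Q\<close> is covered by the charts.\<close>

lemma Q_space_hom_if_charts:
  assumes ext: "m \<in> extensional (topspace (Q_space I G))"
    and hom: "\<And>i. i \<in> I \<Longrightarrow> compose (pts (gl1 i)) m (Q_iota1 I G i) \<in> oTop_hom (Ob G (gl1 i)) M"
  shows "m \<in> oTop_hom (Q_space I G) M"
proof -
  have chart: "m (Q_iota1 I G i x) \<in> topspace M" if "i \<in> I" "x \<in> pts (gl1 i)" for i x
    using oTop_hom_image[OF hom] that by (metis compose_eq)
  have "continuous_map (Q_space I G) M m"
    unfolding continuous_map_def
  proof (intro conjI allI impI)
    show "m \<in> topspace (Q_space I G) \<rightarrow> topspace M"
      using chart by (auto simp: topspace_Q_space)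
    fix U assume U: "openin M U"
    have "openin (Ob G (gl1 i))
        {x \<in> pts (gl1 i). Q_iota1 I G i x \<in> {q \<in> topspace (Q_space I G). m q \<in> U}}"
      if i: "i \<in> I" for i
    proof -
      have "{x \<in> pts (gl1 i). Q_iota1 I G i x \<in> {q \<in> topspace (Q_space I G). m q \<in> U}} =
        {x \<in> pts (gl1 i). compose (pts (gl1 i)) m (Q_iota1 I G i) x \<in> U}"
        using i by (auto simp: topspace_Q_space compose_eq)
      then show ?thesis
        using oTop_hom_preimage[OF hom[OF i] U] by simp
    qed
    then show "openin (Q_space I G) {q \<in> topspace (Q_space I G). m q \<in> U}"
      unfolding openin_Q_space by (auto simp: topspace_Q_space)
  qed
  moreover have "open_map (Q_space I G) M m"
    unfolding open_map_def
  proof (intro allI impI)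
    fix U assume U: "openin (Q_space I G) U"
    let ?U = "\<lambda>i. {x \<in> pts (gl1 i). Q_iota1 I G i x \<in> U}"
    have "m ` U = (\<Union>i\<in>I. compose (pts (gl1 i)) m (Q_iota1 I G i) ` ?U i)"
    proof
      show "m ` U \<subseteq> (\<Union>i\<in>I. compose (pts (gl1 i)) m (Q_iota1 I G i) ` ?U i)"
      proof
        fix z assume "z \<in> m ` U"
        then obtain q where q: "q \<in> U" "z = m q" by blast
        then obtain i x where "i \<in> I" "x \<in> pts (gl1 i)" "q = Q_iota1 I G i x"
          using U unfolding openin_Q_space by blast
        with q show "z \<in> (\<Union>i\<in>I. compose (pts (gl1 i)) m (Q_iota1 I G i) ` ?U i)"
          by (force simp: compose_eq)
      qed
    qed (auto simp: compose_eq)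
    moreover have "openin M (compose (pts (gl1 i)) m (Q_iota1 I G i) ` ?U i)" if "i \<in> I" for i
      using oTop_hom_open_image[OF hom[OF that]] U that unfolding openin_Q_space by blast
    ultimately show "openin M (m ` U)"
      by auto
  qed
  ultimately show ?thesis
    using ext by (auto simp: oTop_hom_def)
qed

text \<open>The charts are jointly surjective, so a mediating map is determined by its values
  \<open>\<mu> (gl1 i) x\<close> on them, and these agree on glued points.\<close>

lemma Q_space_mediating:
  assumes cone: "gl_cone I G M \<mu>"
  shows "\<exists>!m. m \<in> oTop_hom (Q_space I G) M \<and>
           (\<forall>a \<in> gl_obj I. compose (pts a) m (Q_iota I G a) = \<mu> a)"
proof -
  have \<mu>: "\<mu> a \<in> oTop_hom (Ob G a) M" if "a \<in> gl_obj I" for a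
    using cone that unfolding gl_cone_def by blast
  \<comment> \<open>All candidate values at a class agree, so the choice is harmless.\<close>
  define m where "m = (\<lambda>q\<in>topspace (Q_space I G).
    SOME z. \<exists>i\<in>I. \<exists>x\<in>pts (gl1 i). q = Q_iota1 I G i x \<and> z = \<mu> (gl1 i) x)"
  have m: "m (Q_iota1 I G i x) = \<mu> (gl1 i) x" if i: "i \<in> I" and x: "x \<in> pts (gl1 i)" for i x
  proof -
    have q: "Q_iota1 I G i x \<in> topspace (Q_space I G)"
      using i x by (auto simp: topspace_Q_space)
    have "(SOME z. \<exists>j\<in>I. \<exists>y\<in>pts (gl1 j). Q_iota1 I G i x = Q_iota1 I G j y \<and> z = \<mu> (gl1 j) y)
      = \<mu> (gl1 i) x"
    proof (rule some_equality)
      show "\<exists>j\<in>I. \<exists>y\<in>pts (gl1 j). Q_iota1 I G i x = Q_iota1 I G j y \<and> \<mu> (gl1 i) x = \<mu> (gl1 j) y"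
        using i x by blast
    next
      fix z assume "\<exists>j\<in>I. \<exists>y\<in>pts (gl1 j). Q_iota1 I G i x = Q_iota1 I G j y \<and> z = \<mu> (gl1 j) y"
      then show "z = \<mu> (gl1 i) x"
        using cone_gl_rel[OF cone] Q_iota1_eq_iff i x by metis
    qed
    then show ?thesis
      using q by (simp add: m_def)
  qed
  have "m \<in> oTop_hom (Q_space I G) M"
  proof (rule Q_space_hom_if_charts)
    show "m \<in> extensional (topspace (Q_space I G))"
      by (simp add: m_def)
    fix i assume i: "i \<in> I"
    have "\<mu> (gl1 i) \<in> extensional (pts (gl1 i))"
      using \<mu>[of "gl1 i"] i by (auto simp: oTop_hom_def)
    then have "compose (pts (gl1 i)) m (Q_iota1 I G i) = \<mu> (gl1 i)"
      using m[OF i] by (intro extensionalityI[of _ "pts (gl1 i)"]) (auto simp: compose_eq)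
    then show "compose (pts (gl1 i)) m (Q_iota1 I G i) \<in> oTop_hom (Ob G (gl1 i)) M"
      using \<mu>[of "gl1 i"] i by simp
  qed
  moreover have "compose (pts a) m (Q_iota I G a) = \<mu> a" if a: "a \<in> gl_obj I" for a
  proof (rule extensionalityI[of _ "pts a"])
    show "\<mu> a \<in> extensional (pts a)"
      using \<mu>[OF a] by (auto simp: oTop_hom_def)
    fix w assume w: "w \<in> pts a"
    have "\<mu> a = compose (pts a) (\<mu> (gl1 (gl_fst a))) (Mor G (gl1 (gl_fst a)) a)"
      using cone gl_hom_fst[OF a] unfolding gl_cone_def by blast
    then have "\<mu> a w = \<mu> (gl1 (gl_fst a)) (Mor G (gl1 (gl_fst a)) a w)"
      using w by (metis compose_eq)
    then show "compose (pts a) m (Q_iota I G a) w = \<mu> a w"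
      using w a by (simp add: compose_eq Q_iota_apply m Mor_pts gl_hom_fst gl_fst_mem)
  qed simp
  moreover have "m' = m"
    if m': "m' \<in> oTop_hom (Q_space I G) M"
      and eq: "\<forall>a \<in> gl_obj I. compose (pts a) m' (Q_iota I G a) = \<mu> a" for m'
  proof (rule extensionalityI[of _ "topspace (Q_space I G)"])
    show "m' \<in> extensional (topspace (Q_space I G))"
      using m' by (auto simp: oTop_hom_def)
    show "m \<in> extensional (topspace (Q_space I G))"
      by (simp add: m_def)
    fix q assume "q \<in> topspace (Q_space I G)"
    then obtain i x where ix: "i \<in> I" "x \<in> pts (gl1 i)" "q = Q_iota1 I G i x"
      by (auto simp: topspace_Q_space)
    have "compose (pts (gl1 i)) m' (Q_iota1 I G i) = \<mu> (gl1 i)"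
      using eq ix(1) by (simp flip: Q_iota_gl1)
    then show "m' q = m q"
      using ix m by (metis compose_eq)
  qed
  ultimately show ?thesis
    by blast
qed

lemma Q_space_limit: "gl_limit TYPE('t) I G (Q_space I G) (Q_iota I G)"
  unfolding gl_limit_def using Q_iota_cone Q_space_mediating by blast

end

lemma gl_cone_iso_refl:
  assumes "gl_cone I G L \<pi>"
  shows "gl_cone_iso I G L \<pi> L \<pi>"
proof -
  have "compose (topspace (Ob G a)) (oTop_id L) (\<pi> a) = \<pi> a" if "a \<in> gl_obj I" for a
  proof -
    have h: "\<pi> a \<in> oTop_hom (Ob G a) L"
      using assms that unfolding gl_cone_def by blast
    show ?thesis
      using oTop_hom_image[OF h] h
      by (intro extensionalityI[of _ "topspace (Ob G a)"])
        (auto simp: compose_eq oTop_id_def oTop_hom_def)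
  qed
  moreover have "compose (topspace L) (oTop_id L) (oTop_id L) = oTop_id L"
    by (auto simp: compose_def oTop_id_def)
  ultimately show ?thesis
    unfolding gl_cone_iso_def using oTop_id_hom by blast
qed

theorem lemma2p9:
  fixes I :: "'i set" and G :: "('i, 'a) gl_diagram"
  assumes "gluing_data_functor TYPE('a \<times> 'a) I G"
  shows "(\<forall>i\<in>I. embedding_map (Ob G (gl1 i)) (Q_space I G) (Q_iota1 I G i)) \<and>
         (\<forall>i\<in>I. openin (Q_space I G) (Q_iota1 I G i ` topspace (Ob G (gl1 i)))) \<and>
         topspace (Q_space I G) = (\<Union>i\<in>I. Q_iota1 I G i ` topspace (Ob G (gl1 i))) \<and>
         glued_up TYPE('t) I G (Q_space I G) (Q_iota I G)"
proof -
  interpret oTop_gluing I G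
    using assms by unfold_locales
  have "openin (Q_space I G) (Q_iota1 I G i ` topspace (Ob G (gl1 i)))" if "i \<in> I" for i
    using oTop_hom_open_image[OF Q_iota1_hom[OF that]] by simp
  moreover have "glued_up TYPE('t) I G (Q_space I G) (Q_iota I G)"
    unfolding glued_up_def using Q_iota_cone Q_space_limit gl_cone_iso_refl by blast
  ultimately show ?thesis
    using Q_iota1_embedding topspace_Q_space by blast
qed

end
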